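(* Let $M$ be an approximation scheme that is inductively coherent with respect to the theory $T$. Then $P(\phi):=\lim_{n\to\infty}M_n(\phi)$ is well-defined (the limit exists for every sentence $\phi\in\mathcal{L}$), and the function $P:\mathcal{L}\to[0,1]$ is approximable and coherent with respect to $T$.
   Context: $T$ is a fixed first-order theory powerful enough to make claims about computations (such as Peano Arithmetic), and $\mathcal{L}$ is the set of sentences in its language. Coherence. A function $P:\mathcal{L}\to[0,1]$ is coherent with respect to $T$ if (1) $P(\phi)=1$ whenever $\phi$ is a theorem of $T$; and (2) $P(\phi\vee\psi)=P(\phi)+P(\psi)$ whenever $\neg(\phi\wedge\psi)$ is a theorem of $T$. Approximation scheme. A Turing machine $M$ which takes as input a natural number $n$ and an encoding of a sentence $\phi$, and outputs a rational number $M_n(\phi)\in\mathbb{Q}\cap[0,1]$. It approximates $P:\mathcal{L}\to[0,1]$ if $\lim_{n\to\infty}M_n(\phi)=P(\phi)$ for all $\phi$; $P$ is approximable if some approximation scheme approximates it. Quickly computable. A sequence of sentences $\{\phi_n\}$ is quickly computable if there is a Turing machine that outputs all the sentences of the sequence in order, and outputs $\phi_n$ by a time polynomial in $n$. Inductive coherence. An approximation scheme $M$ is inductively coherent with respect to $T$ if: 1. $\lim_{n\to\infty}M_n(\bot)=0$; 2. $\lim_{n\to\infty}M_n(\phi_n)$ converges whenever $\{\phi_n\}$ is quickly computable and $\phi_n\to\phi_{n+1}$ is provable in $T$ for all $n$; 3. $\lim_{n\to\infty}\big(M_n(\phi_n)+M_n(\psi_n)+M_n(\chi_n)\big)=1$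 whenever $\{\phi_n\},\{\psi_n\},\{\chi_n\}$ are quickly computable and for all $n$ it is provable in $T$ that exactly one of $\phi_n,\psi_n,\chi_n$ is true. *)

theory Defs
  imports "HOL-Computational_Algebra.Polynomial"
begin

section \<open>First-order logic with equality\<close>

text \<open>Variables are de Bruijn indices. A symbol is a name together with an arity, the arity being
  the number of arguments it is applied to.\<close>

datatype tm = Var nat | Fn nat "tm list"

datatype fm =
    Falsum
  | Equal tm tm
  | Pred nat "tm list"
  | Neg fm
  | Conj fm fm
  | Disj fm fm
  | Impl fm fm
  | Forall fm
  | Exists fm

definition Iff :: "fm \<Rightarrow> fm \<Rightarrow> fm" where
  "Iff p q = Conj (Impl p q) (Impl q p)"

definition ExactlyOne :: "fm \<Rightarrow> fm \<Rightarrow> fm \<Rightarrow> fm" where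
  "ExactlyOne p q r =
     Conj (Disj p (Disj q r))
       (Conj (Neg (Conj p q)) (Conj (Neg (Conj p r)) (Neg (Conj q r))))"

record language =
  funs :: "(nat \<times> nat) set"
  preds :: "(nat \<times> nat) set"

text \<open>The argument \<open>k\<close> bounds the free variables: they all have index less than \<open>k\<close>.\<close>

fun is_term :: "language \<Rightarrow> nat \<Rightarrow> tm \<Rightarrow> bool" where
  "is_term L k (Var i) \<longleftrightarrow> i < k"
| "is_term L k (Fn f ts) \<longleftrightarrow> (f, length ts) \<in> funs L \<and> (\<forall>t\<in>set ts. is_term L k t)"

fun is_formula :: "language \<Rightarrow> nat \<Rightarrow> fm \<Rightarrow> bool" where
  "is_formula L k Falsum \<longleftrightarrow> True"
| "is_formula L k (Equal s t) \<longleftrightarrow> is_term L k s \<and> is_term L k t"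
| "is_formula L k (Pred r ts) \<longleftrightarrow> (r, length ts) \<in> preds L \<and> (\<forall>t\<in>set ts. is_term L k t)"
| "is_formula L k (Neg p) \<longleftrightarrow> is_formula L k p"
| "is_formula L k (Conj p q) \<longleftrightarrow> is_formula L k p \<and> is_formula L k q"
| "is_formula L k (Disj p q) \<longleftrightarrow> is_formula L k p \<and> is_formula L k q"
| "is_formula L k (Impl p q) \<longleftrightarrow> is_formula L k p \<and> is_formula L k q"
| "is_formula L k (Forall p) \<longleftrightarrow> is_formula L (Suc k) p"
| "is_formula L k (Exists p) \<longleftrightarrow> is_formula L (Suc k) p"

definition sentences :: "language \<Rightarrow> fm set" where
  "sentences L = {p. is_formula L 0 p}"

fun lift_tm :: "nat \<Rightarrow> tm \<Rightarrow> tm" where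
  "lift_tm k (Var i) = (if i < k then Var i else Var (Suc i))"
| "lift_tm k (Fn f ts) = Fn f (map (lift_tm k) ts)"

fun lift_fm :: "nat \<Rightarrow> fm \<Rightarrow> fm" where
  "lift_fm k Falsum = Falsum"
| "lift_fm k (Equal s t) = Equal (lift_tm k s) (lift_tm k t)"
| "lift_fm k (Pred r ts) = Pred r (map (lift_tm k) ts)"
| "lift_fm k (Neg p) = Neg (lift_fm k p)"
| "lift_fm k (Conj p q) = Conj (lift_fm k p) (lift_fm k q)"
| "lift_fm k (Disj p q) = Disj (lift_fm k p) (lift_fm k q)"
| "lift_fm k (Impl p q) = Impl (lift_fm k p) (lift_fm k q)"
| "lift_fm k (Forall p) = Forall (lift_fm (Suc k) p)"
| "lift_fm k (Exists p) = Exists (lift_fm (Suc k) p)"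

text \<open>Substitution of \<open>u\<close> for index \<open>k\<close>; the larger indices move down by one.\<close>

fun subst_tm :: "nat \<Rightarrow> tm \<Rightarrow> tm \<Rightarrow> tm" where
  "subst_tm k u (Var i) = (if i < k then Var i else if i = k then u else Var (i - 1))"
| "subst_tm k u (Fn f ts) = Fn f (map (subst_tm k u) ts)"

fun subst_fm :: "nat \<Rightarrow> tm \<Rightarrow> fm \<Rightarrow> fm" where
  "subst_fm k u Falsum = Falsum"
| "subst_fm k u (Equal s t) = Equal (subst_tm k u s) (subst_tm k u t)"
| "subst_fm k u (Pred r ts) = Pred r (map (subst_tm k u) ts)"
| "subst_fm k u (Neg p) = Neg (subst_fm k u p)"
| "subst_fm k u (Conj p q) = Conj (subst_fm k u p) (subst_fm k u q)"
| "subst_fm k u (Disj p q) = Disj (subst_fm k u p) (subst_fm k u q)"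
| "subst_fm k u (Impl p q) = Impl (subst_fm k u p) (subst_fm k u q)"
| "subst_fm k u (Forall p) = Forall (subst_fm (Suc k) (lift_tm 0 u) p)"
| "subst_fm k u (Exists p) = Exists (subst_fm (Suc k) (lift_tm 0 u) p)"

text \<open>Classical natural deduction. Lifting the hypotheses in \<open>ForallI\<close> and \<open>ExistsE\<close> makes index 0
  an eigenvariable. A derivation may use symbols outside the language of its hypotheses and
  conclusion; this yields no new theorems in that language, since such symbols can be eliminated
  from the derivation.\<close>

inductive provable :: "fm set \<Rightarrow> fm \<Rightarrow> bool" (infix "\<turnstile>" 50) where
  Assm: "p \<in> G \<Longrightarrow> G \<turnstile> p"
| Class: "insert (Neg p) G \<turnstile> Falsum \<Longrightarrow> G \<turnstile> p"
| NegI: "insert p G \<turnstile> Falsum \<Longrightarrow> G \<turnstile> Neg p"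
| NegE: "G \<turnstile> Neg p \<Longrightarrow> G \<turnstile> p \<Longrightarrow> G \<turnstile> Falsum"
| ConjI: "G \<turnstile> p \<Longrightarrow> G \<turnstile> q \<Longrightarrow> G \<turnstile> Conj p q"
| ConjE1: "G \<turnstile> Conj p q \<Longrightarrow> G \<turnstile> p"
| ConjE2: "G \<turnstile> Conj p q \<Longrightarrow> G \<turnstile> q"
| DisjI1: "G \<turnstile> p \<Longrightarrow> G \<turnstile> Disj p q"
| DisjI2: "G \<turnstile> q \<Longrightarrow> G \<turnstile> Disj p q"
| DisjE: "G \<turnstile> Disj p q \<Longrightarrow> insert p G \<turnstile> r \<Longrightarrow> insert q G \<turnstile> r \<Longrightarrow> G \<turnstile> r"
| ImplI: "insert p G \<turnstile> q \<Longrightarrow> G \<turnstile> Impl p q"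
| ImplE: "G \<turnstile> Impl p q \<Longrightarrow> G \<turnstile> p \<Longrightarrow> G \<turnstile> q"
| ForallI: "lift_fm 0 ` G \<turnstile> p \<Longrightarrow> G \<turnstile> Forall p"
| ForallE: "G \<turnstile> Forall p \<Longrightarrow> G \<turnstile> subst_fm 0 t p"
| ExistsI: "G \<turnstile> subst_fm 0 t p \<Longrightarrow> G \<turnstile> Exists p"
| ExistsE: "G \<turnstile> Exists p \<Longrightarrow> insert p (lift_fm 0 ` G) \<turnstile> lift_fm 0 q \<Longrightarrow> G \<turnstile> q"
| EqualI: "G \<turnstile> Equal t t"
| EqualE: "G \<turnstile> Equal s t \<Longrightarrow> G \<turnstile> subst_fm 0 s p \<Longrightarrow> G \<turnstile> subst_fm 0 t p"


section \<open>Encodings\<close>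

text \<open>Numbers are written in binary, terms and formulas in prefix notation.\<close>

fun enc_nat :: "nat \<Rightarrow> string" where
  "enc_nat n =
     (if n < 2 then [] else enc_nat (n div 2)) @ (if even n then ''0'' else ''1'')"

declare enc_nat.simps [simp del]

fun enc_tm :: "tm \<Rightarrow> string" where
  "enc_tm (Var i) = ''x'' @ enc_nat i"
| "enc_tm (Fn f ts) = ''f'' @ enc_nat f @ ''('' @ concat (map enc_tm ts) @ '')''"

fun enc_fm :: "fm \<Rightarrow> string" where
  "enc_fm Falsum = ''F''"
| "enc_fm (Equal s t) = ''='' @ enc_tm s @ enc_tm t"
| "enc_fm (Pred r ts) = ''R'' @ enc_nat r @ ''('' @ concat (map enc_tm ts) @ '')''"
| "enc_fm (Neg p) = ''~'' @ enc_fm p"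
| "enc_fm (Conj p q) = ''&'' @ enc_fm p @ enc_fm q"
| "enc_fm (Disj p q) = ''|'' @ enc_fm p @ enc_fm q"
| "enc_fm (Impl p q) = ''>'' @ enc_fm p @ enc_fm q"
| "enc_fm (Forall p) = ''A'' @ enc_fm p"
| "enc_fm (Exists p) = ''E'' @ enc_fm p"

text \<open>Only meant for nonnegative rationals; numerator and denominator are in lowest terms.\<close>

definition enc_rat :: "rat \<Rightarrow> string" where
  "enc_rat q =
     enc_nat (nat (fst (quotient_of q))) @ ''/'' @ enc_nat (nat (snd (quotient_of q)))"


section \<open>Turing machines\<close>

text \<open>A machine has one two-way infinite work tape, which initially holds the input, and a
  write-only output tape to which each step appends at most one character.\<close>

datatype symbol = Blank | Char char | Aux nat

datatype move = MoveLeft | Stay | MoveRight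

record machine =
  states :: "nat set"
  alphabet :: "symbol set"
  start :: nat
  trans :: "nat \<Rightarrow> symbol \<Rightarrow> (nat \<times> symbol \<times> move \<times> char option) option"

definition turing_machine :: "machine \<Rightarrow> bool" where
  "turing_machine M \<longleftrightarrow>
     finite (states M) \<and> finite (alphabet M) \<and> start M \<in> states M \<and>
     insert Blank (range Char) \<subseteq> alphabet M \<and>
     (\<forall>q\<in>states M. \<forall>s\<in>alphabet M. \<forall>q' s' m c.
        trans M q s = Some (q', s', m, c) \<longrightarrow> q' \<in> states M \<and> s' \<in> alphabet M)"

record config =
  state :: nat
  head :: int
  tape :: "int \<Rightarrow> symbol"
  out :: string

fun displacement :: "move \<Rightarrow> int" where
  "displacement MoveLeft = - 1"
| "displacement Stay = 0"
| "displacement MoveRight = 1"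

definition init :: "machine \<Rightarrow> string \<Rightarrow> config" where
  "init M w = \<lparr>state = start M, head = 0,
     tape = (\<lambda>i. if 0 \<le> i \<and> i < int (length w) then Char (w ! nat i) else Blank), out = []\<rparr>"

definition next_action :: "machine \<Rightarrow> config \<Rightarrow> (nat \<times> symbol \<times> move \<times> char option) option" where
  "next_action M c = trans M (state c) (tape c (head c))"

definition halted :: "machine \<Rightarrow> config \<Rightarrow> bool" where
  "halted M c \<longleftrightarrow> next_action M c = None"

definition step :: "machine \<Rightarrow> config \<Rightarrow> config" where
  "step M c = (case next_action M c of
       None \<Rightarrow> c
     | Some (q, s, m, w) \<Rightarrow>
         \<lparr>state = q, head = head c + displacement m, tape = (tape c)(head c := s),
          out = out c @ (case w of None \<Rightarrow> [] | Some a \<Rightarrow> [a])\<rparr>)"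

definition run :: "machine \<Rightarrow> string \<Rightarrow> nat \<Rightarrow> config" where
  "run M w k = (step M ^^ k) (init M w)"

definition computes :: "machine \<Rightarrow> string \<Rightarrow> string \<Rightarrow> bool" where
  "computes M w u \<longleftrightarrow> (\<exists>k. halted M (run M w k) \<and> out (run M w k) = u)"

definition computable :: "(nat \<Rightarrow> nat) \<Rightarrow> bool" where
  "computable f \<longleftrightarrow>
     (\<exists>M. turing_machine M \<and> (\<forall>n. computes M (enc_nat n) (enc_nat (f n))))"


section \<open>Theories that can talk about computations\<close>

text \<open>Every computable function is representable. The numeral of \<open>n\<close> is given by a formula
  \<open>num n\<close> defining it, so that theories without closed terms, such as set theory, are covered; the
  first clauses say that it defines exactly one object, and that distinct numerals are distinct.
  Under two quantifiers \<open>lift_fm 0 (num n)\<close> speaks about variable 1, \<open>num n\<close> about variable 0. In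
  the last clause variable 1 is the input and variable 0 the output.\<close>

definition represents_computations :: "language \<Rightarrow> fm set \<Rightarrow> bool" where
  "represents_computations L T \<longleftrightarrow>
     (\<exists>num.
        (\<forall>n. is_formula L 1 (num n)) \<and>
        (\<forall>n. T \<turnstile> Exists (num n)) \<and>
        (\<forall>n. T \<turnstile> Forall (Forall
           (Impl (Conj (lift_fm 0 (num n)) (num n)) (Equal (Var 1) (Var 0))))) \<and>
        (\<forall>m n. m \<noteq> n \<longrightarrow> T \<turnstile> Neg (Exists (Conj (num m) (num n)))) \<and>
        (\<forall>f. computable f \<longrightarrow>
           (\<exists>p. is_formula L 2 p \<and>
              (\<forall>n. T \<turnstile> Forall (Forall (Impl (lift_fm 0 (num n)) (Iff p (num (f n)))))))))"


section \<open>Coherence and approximation\<close>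

definition coherent :: "language \<Rightarrow> fm set \<Rightarrow> (fm \<Rightarrow> real) \<Rightarrow> bool" where
  "coherent L T P \<longleftrightarrow>
     (\<forall>p\<in>sentences L. P p \<in> {0..1}) \<and>
     (\<forall>p\<in>sentences L. T \<turnstile> p \<longrightarrow> P p = 1) \<and>
     (\<forall>p\<in>sentences L. \<forall>q\<in>sentences L.
        T \<turnstile> Neg (Conj p q) \<longrightarrow> P (Disj p q) = P p + P q)"

definition scheme_input :: "nat \<Rightarrow> fm \<Rightarrow> string" where
  "scheme_input n p = enc_nat n @ '','' @ enc_fm p"

definition approximation_scheme :: "language \<Rightarrow> machine \<Rightarrow> bool" where
  "approximation_scheme L M \<longleftrightarrow> turing_machine M \<and>
     (\<forall>n. \<forall>p\<in>sentences L. \<exists>q\<in>{0..1}. computes M (scheme_input n p) (enc_rat q))"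

text \<open>The value is unique: machines are deterministic and \<open>enc_rat\<close> is injective on nonnegative
  rationals.\<close>

definition scheme_value :: "machine \<Rightarrow> nat \<Rightarrow> fm \<Rightarrow> real" where
  "scheme_value M n p =
     of_rat (THE q. q \<in> {0..1} \<and> computes M (scheme_input n p) (enc_rat q))"

definition approximates :: "language \<Rightarrow> machine \<Rightarrow> (fm \<Rightarrow> real) \<Rightarrow> bool" where
  "approximates L M P \<longleftrightarrow> (\<forall>p\<in>sentences L. (\<lambda>n. scheme_value M n p) \<longlonglongrightarrow> P p)"

definition approximable :: "language \<Rightarrow> (fm \<Rightarrow> real) \<Rightarrow> bool" where
  "approximable L P \<longleftrightarrow> (\<exists>M. approximation_scheme L M \<and> approximates L M P)"

text \<open>The machine starts on empty input and need not halt. Its output tape lists the encoded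
  sentences, each closed by a semicolon, which no encoding contains. The first \<open>Suc n\<close> of them are
  complete after at most \<open>b(n)\<close> steps, for a polynomial \<open>b\<close>.\<close>

definition quickly_computable :: "language \<Rightarrow> (nat \<Rightarrow> fm) \<Rightarrow> bool" where
  "quickly_computable L p \<longleftrightarrow>
     (\<forall>n. p n \<in> sentences L) \<and>
     (\<exists>M. turing_machine M \<and>
       (\<exists>b :: nat poly. \<forall>n. \<exists>k \<le> poly b n.
          out (run M [] k) = concat (map (\<lambda>i. enc_fm (p i) @ '';'') [0..<Suc n])))"

definition inductively_coherent :: "language \<Rightarrow> fm set \<Rightarrow> machine \<Rightarrow> bool" where
  "inductively_coherent L T M \<longleftrightarrow>
     (\<lambda>n. scheme_value M n Falsum) \<longlonglongrightarrow> 0 \<and>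
     (\<forall>p. quickly_computable L p \<and> (\<forall>n. T \<turnstile> Impl (p n) (p (Suc n))) \<longrightarrow>
        convergent (\<lambda>n. scheme_value M n (p n))) \<and>
     (\<forall>p q r. quickly_computable L p \<and> quickly_computable L q \<and> quickly_computable L r \<and>
        (\<forall>n. T \<turnstile> ExactlyOne (p n) (q n) (r n)) \<longrightarrow>
        (\<lambda>n. scheme_value M n (p n) + scheme_value M n (q n) + scheme_value M n (r n))
          \<longlonglongrightarrow> 1)"

end

theory Submission
  imports Defs
begin

text \<open>A constant sequence of sentences is quickly computable, by a machine that prints the same
  string in a loop, so the conditions on \<open>M\<close> apply to constant sequences. Convergence of
  \<open>M\<^sub>n(\<phi>)\<close> then follows from \<open>\<phi> \<rightarrow> \<phi>\<close>. For a theorem \<open>\<phi>\<close>, exactly one of \<open>\<phi>, \<bottom>, \<bottom>\<close> holds, so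
  \<open>P \<phi> = 1\<close>. For incompatible \<open>\<phi>, \<psi>\<close>, exactly one of \<open>\<phi>, \<psi>, \<not>(\<phi> \<or> \<psi>)\<close> holds, and
  exactly one of \<open>\<phi> \<or> \<psi>, \<not>(\<phi> \<or> \<psi>), \<bottom>\<close>; subtracting the two equations gives additivity.
  Finally \<open>M\<close> itself approximates \<open>P\<close>.\<close>

text \<open>Horner's rule reads the binary digits back, most significant first. A left inverse of
  \<open>enc_nat\<close> gives its injectivity.\<close>

lemma foldl_enc_nat:
  "foldl (\<lambda>a c. 2 * a + (if c = CHR ''1'' then 1 else 0)) 0 (enc_nat n) = n"
proof (induction n rule: less_induct)
  case (less n)
  show ?case
  proof (cases "n < 2")
    case True
    then show ?thesis by (subst enc_nat.simps) (auto simp: less_2_cases_iff)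
  next
    case False
    then show ?thesis using less[of "n div 2"] by (subst enc_nat.simps) auto
  qed
qed

lemma enc_nat_eq_iff [simp]: "enc_nat m = enc_nat n \<longleftrightarrow> m = n"
  using foldl_enc_nat by metis

lemma set_enc_nat: "set (enc_nat n) \<subseteq> {CHR ''0'', CHR ''1''}"
proof (induction n rule: less_induct)
  case (less n)
  show ?case
    using less[of "n div 2"] by (subst enc_nat.simps) auto
qed

text \<open>The slash is no binary digit, so cutting at it separates numerator from denominator.
  Nonnegativity matters because \<open>nat\<close> sends every negative numerator to 0.\<close>

lemma enc_rat_inject:
  assumes "0 \<le> p" "0 \<le> q" and eq: "enc_rat p = enc_rat q"
  shows "p = q"
proof -
  have slash: "CHR ''/'' \<notin> set (enc_nat n)" for n
    using set_enc_nat[of n] by auto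
  have takew: "takeWhile (\<lambda>c. c \<noteq> CHR ''/'') (enc_nat m @ ''/'' @ w) = enc_nat m" for m w
    using slash[of m] by (subst takeWhile_append2) auto
  have fst_eq: "nat (fst (quotient_of p)) = nat (fst (quotient_of q))"
    using arg_cong[OF eq, of "takeWhile (\<lambda>c. c \<noteq> CHR ''/'')"]
    unfolding enc_rat_def takew by simp
  then have snd_eq: "nat (snd (quotient_of p)) = nat (snd (quotient_of q))"
    using eq unfolding enc_rat_def by simp
  have nonneg: "0 \<le> fst (quotient_of r)" if "0 \<le> r" for r
  proof -
    have "0 \<le> rat_of_int (fst (quotient_of r)) / rat_of_int (snd (quotient_of r))"
      using that quotient_of_div[of r "fst (quotient_of r)" "snd (quotient_of r)"] by simp
    then show ?thesis
      using quotient_of_denom_pos'[of r] by (simp add: zero_le_divide_iff)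
  qed
  have "fst (quotient_of p) = fst (quotient_of q)"
    using fst_eq nonneg[OF assms(1)] nonneg[OF assms(2)] by (metis nat_0_le)
  moreover have "snd (quotient_of p) = snd (quotient_of q)"
    using snd_eq quotient_of_denom_pos'[of p] quotient_of_denom_pos'[of q] by simp
  ultimately show ?thesis
    by (metis prod_eq_iff quotient_of_inject)
qed

lemma run_halted:
  assumes "halted M (run M w k)" "k \<le> j"
  shows "run M w j = run M w k"
  using assms(2)
proof (induction j rule: dec_induct)
  case (step j)
  have "run M w (Suc j) = Defs.step M (run M w j)"
    by (simp add: run_def)
  then show ?case
    using step.IH assms(1) by (simp add: Defs.step_def halted_def)
qed simp

lemma computes_unique:
  assumes "computes M w u" "computes M w v"
  shows "u = v"
proof -
  obtain i j where "halted M (run M w i)" "out (run M w i) = u"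
    "halted M (run M w j)" "out (run M w j) = v"
    using assms unfolding computes_def by blast
  then show ?thesis
    using run_halted[of M w i j] run_halted[of M w j i] by (metis nat_le_linear)
qed

text \<open>\<open>scheme_value\<close> is a definite description, so it must first be shown to
  denote: existence comes from the scheme, uniqueness from determinism and the injectivity of
  \<open>enc_rat\<close>.\<close>

lemma scheme_value_bounds:
  assumes "approximation_scheme L M" "p \<in> sentences L"
  shows "scheme_value M n p \<in> {0..1}"
proof -
  let ?Q = "\<lambda>q::rat. q \<in> {0..1} \<and> computes M (scheme_input n p) (enc_rat q)"
  obtain q where q: "?Q q"
    using assms unfolding approximation_scheme_def by blast
  have "(THE q. ?Q q) = q"
  proof (intro the_equality)
    show "r = q" if "?Q r" for r
      using that q computes_unique[of M "scheme_input n p" "enc_rat r" "enc_rat q"]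
      by (intro enc_rat_inject) simp_all
  qed (fact q)
  then show ?thesis
    using q by (simp add: scheme_value_def)
qed

text \<open>The state is the position in \<open>s\<close> of the next character to print. The tape
  is never changed and the head never moves.\<close>

definition loop_machine :: "string \<Rightarrow> machine" where
  "loop_machine s = \<lparr>states = {..<length s}, alphabet = insert Blank (range Char), start = 0,
     trans = (\<lambda>q a. Some (Suc q mod length s, a, Stay, Some (s ! q)))\<rparr>"

lemma turing_machine_loop: "s \<noteq> [] \<Longrightarrow> turing_machine (loop_machine s)"
  by (auto simp: turing_machine_def loop_machine_def)

lemma run_loop:
  assumes "s \<noteq> []"
  shows "state (run (loop_machine s) [] k) = k mod length s \<and>
    out (run (loop_machine s) [] k) = map (\<lambda>i. s ! (i mod length s)) [0..<k]"
proof (induction k)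
  case 0
  show ?case by (simp add: run_def init_def loop_machine_def)
next
  case (Suc k)
  have "run (loop_machine s) [] (Suc k) = step (loop_machine s) (run (loop_machine s) [] k)"
    by (simp add: run_def)
  then show ?case
    using Suc by (simp add: step_def next_action_def loop_machine_def mod_Suc_eq)
qed

text \<open>Every block of \<open>length s\<close> consecutive indices starting at a multiple of
  \<open>length s\<close> spells \<open>s\<close> once.\<close>

lemma map_nth_mod:
  "map (\<lambda>i. s ! (i mod length s)) [0..<m * length s] = concat (replicate m s)"
proof (induction m)
  case (Suc m)
  have "map (\<lambda>i. s ! (i mod length s)) [m * length s..<m * length s + length s] = s"
    by (rule nth_equalityI) auto
  moreover have "[0..<Suc m * length s] =
      [0..<m * length s] @ [m * length s..<m * length s + length s]"
    using upt_add_eq_append[of 0 "m * length s" "length s"] by (simp only: mult_Suc add.commute)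
  moreover have "concat (replicate (Suc m) s) = concat (replicate m s @ [s])"
    by (simp only: replicate_append_same replicate_Suc)
  ultimately show ?case
    using Suc by simp
qed simp

lemma quickly_computable_const:
  assumes "p \<in> sentences L"
  shows "quickly_computable L (\<lambda>_. p)"
proof -
  define s where "s = enc_fm p @ '';''"
  have s: "s \<noteq> []" by (simp add: s_def)
  have "out (run (loop_machine s) [] (Suc n * length s)) =
      concat (map (\<lambda>i. enc_fm p @ '';'') [0..<Suc n])" for n
    using run_loop[OF s] map_nth_mod[of s "Suc n"]
    by (simp add: s_def[symmetric] map_replicate_const del: upt_Suc mult_Suc)
  \<comment> \<open>One character is printed per step, so \<open>Suc n\<close> copies take
    \<open>Suc n * length s\<close> steps, which is linear in \<open>n\<close>.\<close>
  moreover have "Suc n * length s \<le> poly [:length s, length s:] n" for n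
    by simp
  ultimately show ?thesis
    unfolding quickly_computable_def
    using assms turing_machine_loop[OF s] by blast
qed

lemma provable_Impl_refl: "G \<turnstile> Impl p p"
  by (intro ImplI Assm insertI1)

lemma ExactlyOne_theorem:
  assumes "G \<turnstile> p"
  shows "G \<turnstile> ExactlyOne p Falsum Falsum"
proof -
  \<comment> \<open>The instances \<open>p\<close> and \<open>Falsum\<close> of \<open>q\<close>
    cover all three exclusion clauses.\<close>
  have "G \<turnstile> Neg (Conj q Falsum)" for q
    by (rule NegI, rule ConjE2[of _ q], rule Assm) simp
  then show ?thesis
    unfolding ExactlyOne_def using assms by (intro ConjI DisjI1)
qed

text \<open>By contradiction: under the negated disjunction \<open>p\<close> is refutable, which
  yields the right disjunct after all.\<close>

lemma provable_excluded_middle: "G \<turnstile> Disj p (Neg p)"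
proof -
  let ?H = "insert (Neg (Disj p (Neg p))) G"
  have neg: "insert p ?H \<turnstile> Neg (Disj p (Neg p))" "?H \<turnstile> Neg (Disj p (Neg p))"
    by (simp_all add: Assm)
  have "insert p ?H \<turnstile> Falsum"
    by (rule NegE[OF neg(1)], rule DisjI1, rule Assm) simp
  then have "?H \<turnstile> Disj p (Neg p)"
    by (intro DisjI2 NegI)
  then show ?thesis
    by (intro Class[OF NegE[OF neg(2)]])
qed

lemma provable_noncontradiction: "G \<turnstile> Neg (Conj p (Neg p))"
proof -
  have "insert (Conj p (Neg p)) G \<turnstile> Conj p (Neg p)"
    by (simp add: Assm)
  then show ?thesis
    by (intro NegI) (blast intro: NegE ConjE1 ConjE2)
qed

text \<open>Inductive coherence speaks of triples only, so \<open>Falsum\<close> pads the two-way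
  split.\<close>

lemma ExactlyOne_complement: "G \<turnstile> ExactlyOne p (Neg p) Falsum"
proof -
  have f: "G \<turnstile> Neg (Conj q Falsum)" for q
    by (rule NegI, rule ConjE2[of _ q], rule Assm) simp
  have "G \<turnstile> Disj p (Disj (Neg p) Falsum)"
  proof (rule DisjE[OF provable_excluded_middle[of G p]])
    show "insert p G \<turnstile> Disj p (Disj (Neg p) Falsum)"
      by (rule DisjI1, rule Assm) simp
    show "insert (Neg p) G \<turnstile> Disj p (Disj (Neg p) Falsum)"
      by (rule DisjI2, rule DisjI1, rule Assm) simp
  qed
  then show ?thesis
    unfolding ExactlyOne_def using f provable_noncontradiction by (intro ConjI)
qed

lemma ExactlyOne_incompatible:
  assumes "G \<turnstile> Neg (Conj p q)"
  shows "G \<turnstile> ExactlyOne p q (Neg (Disj p q))"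
proof -
  let ?D = "Disj p q"
  \<comment> \<open>Each disjunct proves \<open>?D\<close>, which excludes both pairs containing
    \<open>Neg ?D\<close>; the remaining pair is the assumption.\<close>
  have 1: "G \<turnstile> Neg (Conj r (Neg ?D))" if "r = p \<or> r = q" for r
  proof -
    let ?H = "insert (Conj r (Neg ?D)) G"
    have H: "?H \<turnstile> Conj r (Neg ?D)"
      by (simp add: Assm)
    from that have "?H \<turnstile> ?D"
      using ConjE1[OF H] by (auto intro: DisjI1 DisjI2)
    then show ?thesis
      by (rule NegI[OF NegE[OF ConjE2[OF H]]])
  qed
  have "G \<turnstile> Disj p (Disj q (Neg ?D))"
  proof (rule DisjE[OF provable_excluded_middle[of G ?D]])
    show "insert ?D G \<turnstile> Disj p (Disj q (Neg ?D))"
    proof (rule DisjE[of _ p q])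
      show "insert ?D G \<turnstile> ?D"
        by (simp add: Assm)
      show "insert p (insert ?D G) \<turnstile> Disj p (Disj q (Neg ?D))"
        by (rule DisjI1, rule Assm) simp
      show "insert q (insert ?D G) \<turnstile> Disj p (Disj q (Neg ?D))"
        by (rule DisjI2, rule DisjI1, rule Assm) simp
    qed
    show "insert (Neg ?D) G \<turnstile> Disj p (Disj q (Neg ?D))"
      by (rule DisjI2, rule DisjI2, rule Assm) simp
  qed
  then show ?thesis
    unfolding ExactlyOne_def using assms 1 by (intro ConjI) auto
qed

theorem theorem5:
  fixes L :: language and T :: "fm set" and M :: machine
  assumes "T \<subseteq> sentences L"
    and "represents_computations L T"
    and "approximation_scheme L M"
    and "inductively_coherent L T M"
  shows "(\<forall>p\<in>sentences L. convergent (\<lambda>n. scheme_value M n p)) \<and>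
    (let P = (\<lambda>p. lim (\<lambda>n. scheme_value M n p))
     in (\<forall>p\<in>sentences L. P p \<in> {0..1}) \<and> approximable L P \<and> coherent L T P)"
proof -
  define P where "P p = lim (\<lambda>n. scheme_value M n p)" for p
  have conv: "convergent (\<lambda>n. scheme_value M n p)" if "p \<in> sentences L" for p
    using assms(4) quickly_computable_const[OF that] provable_Impl_refl
    unfolding inductively_coherent_def by blast
  then have P: "(\<lambda>n. scheme_value M n p) \<longlonglongrightarrow> P p" if "p \<in> sentences L" for p
    using that by (simp add: P_def convergent_LIMSEQ_iff)
  have bounds: "P p \<in> {0..1}" if "p \<in> sentences L" for p
    \<comment> \<open>The unit interval is closed, so it contains the limits of its
      sequences.\<close>
    by (rule closed_sequentially[OF closed_atLeastAtMost _ P[OF that]])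
      (rule scheme_value_bounds[OF assms(3) that])
  have Falsum: "P Falsum = 0"
    using assms(4) unfolding inductively_coherent_def P_def by (blast intro: limI)
  \<comment> \<open>Stated for sequences, so that constant functions can be supplied explicitly as
    instances.\<close>
  have exactly_one_lim: "\<forall>p q r. quickly_computable L p \<and> quickly_computable L q \<and> quickly_computable L r \<and>
      (\<forall>n. T \<turnstile> ExactlyOne (p n) (q n) (r n)) \<longrightarrow>
      (\<lambda>n. scheme_value M n (p n) + scheme_value M n (q n) + scheme_value M n (r n)) \<longlonglongrightarrow> 1"
    using assms(4) unfolding inductively_coherent_def by (elim conjE)
  have exactly_one: "P p + P q + P r = 1"
    if "p \<in> sentences L" "q \<in> sentences L" "r \<in> sentences L" "T \<turnstile> ExactlyOne p q r" for p q r
  proof (rule LIMSEQ_unique)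
    show "(\<lambda>n. scheme_value M n p + scheme_value M n q + scheme_value M n r)
        \<longlonglongrightarrow> P p + P q + P r"
      using P that by (intro tendsto_add)
    show "(\<lambda>n. scheme_value M n p + scheme_value M n q + scheme_value M n r) \<longlonglongrightarrow> 1"
      using exactly_one_lim[rule_format, of "\<lambda>_. p" "\<lambda>_. q" "\<lambda>_. r"] that quickly_computable_const
      by simp
  qed
  have F: "Falsum \<in> sentences L"
    by (simp add: sentences_def)
  have "P p = 1" if "p \<in> sentences L" "T \<turnstile> p" for p
    using exactly_one[OF that(1) F F ExactlyOne_theorem[OF that(2)]] Falsum by simp
  moreover have "P (Disj p q) = P p + P q"
    if pq: "p \<in> sentences L" "q \<in> sentences L" and incompatible: "T \<turnstile> Neg (Conj p q)" for p q
  proof -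
    have D: "Disj p q \<in> sentences L" "Neg (Disj p q) \<in> sentences L"
      using pq by (simp_all add: sentences_def)
    show ?thesis
      using exactly_one[OF pq D(2) ExactlyOne_incompatible[OF incompatible]]
        exactly_one[OF D F ExactlyOne_complement] Falsum by simp
  qed
  ultimately have "coherent L T P"
    using bounds by (auto simp: coherent_def)
  moreover have "approximable L P"
    using assms(3) P unfolding approximable_def approximates_def by blast
  ultimately show ?thesis
    using conv bounds unfolding Let_def P_def by blast
qed

end
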